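(* Let $\lambda>1$ be a natural number, let $\varepsilon>0$ be a real parameter and let $M\in\mathbb{R}\setminus\{0\}$. Put $e_{-}^{|M|}:=(|M|,-|M|\sqrt{\lambda},0)$ and $e_{+}^{|M|}:=(|M|,|M|\sqrt{\lambda},0)$. The perturbations $p_{+}$ and $p_{-}$ of the rattleback system $\dot x=\lambda xz,\ \dot y=-yz,\ \dot z=y^2-\lambda x^2$ given, for $(x,y,z)\in\mathbb{R}^3$, by $$p_{\pm}:\quad \begin{bmatrix}\dot x\\ \dot y\\ \dot z\end{bmatrix}=\begin{bmatrix}\lambda xz\\ -yz\\ y^2-\lambda x^2\end{bmatrix}+\varepsilon\left(xy^{\lambda}\pm|M|^{\lambda+1}(\sqrt{\lambda})^{\lambda}\right)y^{\lambda-1}\begin{bmatrix} y(\lambda x^2-y^2-z^2)\\ x(-\lambda x^2+y^2-\lambda z^2)\\ (\lambda+1)xyz\end{bmatrix}$$ asymptotically stabilize the Lyapunov stable equilibrium states $\pm e_{-}^{|M|},\pm e_{+}^{|M|}$ of the rattleback system, with respect to perturbations along the invariant manifold $C^{-1}(\{(\lambda+1)M^2/2\})$, where $C(x,y,z)=\frac12(x^2+y^2+z^2)$. More precisely: (1) if $\lambda\in 2\mathbb{N}\setminus\{0\}$, then $p_{-}$ asymptotically stabilizes both equilibrium states $e_{-}^{|M|}$ and $e_{+}^{|M|}$, whereas $p_{+}$ asymptotically stabilizes both equilibrium states $-e_{-}^{|M|}$ and $-e_{+}^{|M|}$; (2) if $\lambda\in(2\mathbb{N}+1)\setminus\{1\}$,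 then $p_{-}$ asymptotically stabilizes both equilibrium states $-e_{+}^{|M|}$ and $e_{+}^{|M|}$, whereas $p_{+}$ asymptotically stabilizes both equilibrium states $-e_{-}^{|M|}$ and $e_{-}^{|M|}$.
   Context: The function $C$ is a first integral both of the rattleback system and of the perturbed systems, so its level sets are dynamically invariant. A perturbed system asymptotically stabilizes an equilibrium state $e$ of the rattleback system, with respect to perturbations along the invariant manifold $C^{-1}(\{C(e)\})$, if $e$ is also an equilibrium of the perturbed system and is asymptotically stable (Lyapunov stable and locally attracting) for the perturbed dynamics restricted to $C^{-1}(\{C(e)\})$. *)

theory Defs
  imports "HOL-Analysis.Analysis"
begin

definition solves :: "(real^3 \<Rightarrow> real^3) \<Rightarrow> real set \<Rightarrow> (real \<Rightarrow> real^3) \<Rightarrow> bool" where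
  "solves f I \<gamma> \<longleftrightarrow> (\<forall>t\<in>I. (\<gamma> has_vector_derivative f (\<gamma> t)) (at t within I))"

definition equilibrium :: "(real^3 \<Rightarrow> real^3) \<Rightarrow> real^3 \<Rightarrow> bool" where
  "equilibrium f e \<longleftrightarrow> f e = 0"

definition invariant_set :: "(real^3 \<Rightarrow> real^3) \<Rightarrow> (real^3) set \<Rightarrow> bool" where
  "invariant_set f S \<longleftrightarrow>
    (\<forall>I \<gamma>. is_interval I \<and> solves f I \<gamma> \<and> (\<exists>t\<in>I. \<gamma> t \<in> S) \<longrightarrow> (\<forall>t\<in>I. \<gamma> t \<in> S))"

definition forward_trajectory :: "(real^3 \<Rightarrow> real^3) \<Rightarrow> real^3 \<Rightarrow> (real \<Rightarrow> real^3) \<Rightarrow> bool" where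
  "forward_trajectory f p \<gamma> \<longleftrightarrow> \<gamma> 0 = p \<and> solves f {0..} \<gamma>"

text \<open>
  ``The trajectory starting at \<open>p\<close> has property \<open>Q\<close>.''  Existence of the trajectory for all
  times \<open>t \<ge> 0\<close> is part of the claim, so the stability notions below are never satisfied
  just because solutions fail to exist.
\<close>

definition trajectory_satisfies ::
    "(real^3 \<Rightarrow> real^3) \<Rightarrow> real^3 \<Rightarrow> ((real \<Rightarrow> real^3) \<Rightarrow> bool) \<Rightarrow> bool" where
  "trajectory_satisfies f p Q \<longleftrightarrow>
    (\<exists>\<gamma>. forward_trajectory f p \<gamma>) \<and> (\<forall>\<gamma>. forward_trajectory f p \<gamma> \<longrightarrow> Q \<gamma>)"

text \<open>
  Stability of \<open>e\<close> for the dynamics restricted to \<open>S\<close>: only initial conditions in \<open>S\<close> are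
  considered.  For \<open>S = UNIV\<close> these are the usual unrestricted notions.
\<close>

definition lyapunov_stable_on :: "(real^3 \<Rightarrow> real^3) \<Rightarrow> (real^3) set \<Rightarrow> real^3 \<Rightarrow> bool" where
  "lyapunov_stable_on f S e \<longleftrightarrow>
    (\<forall>\<eta>>0. \<exists>\<delta>>0. \<forall>p\<in>S. dist p e < \<delta> \<longrightarrow>
      trajectory_satisfies f p (\<lambda>\<gamma>. \<forall>t\<ge>0. dist (\<gamma> t) e < \<eta>))"

definition locally_attracting_on :: "(real^3 \<Rightarrow> real^3) \<Rightarrow> (real^3) set \<Rightarrow> real^3 \<Rightarrow> bool" where
  "locally_attracting_on f S e \<longleftrightarrow>
    (\<exists>\<delta>>0. \<forall>p\<in>S. dist p e < \<delta> \<longrightarrow>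
      trajectory_satisfies f p (\<lambda>\<gamma>. (\<gamma> \<longlongrightarrow> e) at_top))"

definition asymptotically_stable_on :: "(real^3 \<Rightarrow> real^3) \<Rightarrow> (real^3) set \<Rightarrow> real^3 \<Rightarrow> bool" where
  "asymptotically_stable_on f S e \<longleftrightarrow> lyapunov_stable_on f S e \<and> locally_attracting_on f S e"

text \<open>
  The perturbation \<open>g\<close> of \<open>f\<close> asymptotically stabilizes the equilibrium \<open>e\<close> of \<open>f\<close> with respect
  to perturbations along the invariant set \<open>S\<close>.
\<close>

definition asymptotically_stabilizes_along ::
    "(real^3) set \<Rightarrow> (real^3 \<Rightarrow> real^3) \<Rightarrow> (real^3 \<Rightarrow> real^3) \<Rightarrow> real^3 \<Rightarrow> bool" where
  "asymptotically_stabilizes_along S f g e \<longleftrightarrow>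
    invariant_set f S \<and> invariant_set g S \<and> e \<in> S \<and>
    equilibrium f e \<and> equilibrium g e \<and> asymptotically_stable_on g S e"

definition rattleback :: "nat \<Rightarrow> real^3 \<Rightarrow> real^3" where
  "rattleback l r = (let x = r$1; y = r$2; z = r$3 in
    vector [real l * x * z, - y * z, y^2 - real l * x^2])"

definition casimir :: "real^3 \<Rightarrow> real" where
  "casimir r = ((r$1)^2 + (r$2)^2 + (r$3)^2) / 2"

text \<open>The parameter \<open>\<sigma>\<close> is the sign in front of the constant.\<close>

definition perturbed :: "real \<Rightarrow> nat \<Rightarrow> real \<Rightarrow> real \<Rightarrow> real^3 \<Rightarrow> real^3" where
  "perturbed \<sigma> l \<epsilon> M r = (let x = r$1; y = r$2; z = r$3 in
    rattleback l r +
    (\<epsilon> * (x * y^l + \<sigma> * (\<bar>M\<bar>^(l + 1) * (sqrt (real l))^l)) * y^(l - 1)) *\<^sub>R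
      vector [y * (real l * x^2 - y^2 - z^2),
              x * (- real l * x^2 + y^2 - real l * z^2),
              (real l + 1) * x * y * z])"

definition p_plus :: "nat \<Rightarrow> real \<Rightarrow> real \<Rightarrow> real^3 \<Rightarrow> real^3" where
  "p_plus = perturbed 1"

definition p_minus :: "nat \<Rightarrow> real \<Rightarrow> real \<Rightarrow> real^3 \<Rightarrow> real^3" where
  "p_minus = perturbed (- 1)"

definition e_plus :: "nat \<Rightarrow> real \<Rightarrow> real^3" where
  "e_plus l M = vector [\<bar>M\<bar>, \<bar>M\<bar> * sqrt (real l), 0]"

definition e_minus :: "nat \<Rightarrow> real \<Rightarrow> real^3" where
  "e_minus l M = vector [\<bar>M\<bar>, - \<bar>M\<bar> * sqrt (real l), 0]"

end

theory Submission
  imports Defs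
begin

text \<open>
  Besides the Casimir \<open>C = (x\<^sup>2 + y\<^sup>2 + z\<^sup>2)/2\<close> the rattleback system has the first integral
  \<open>D = x y\<^sup>l\<close>, and its vector field times \<open>- (y ^ (l - 1))\<close> is the cross product of
  the two gradients.  With \<open>k\<close> denoting the constant in the perturbation, the added term is
  \<open>- \<epsilon> (D + k)\<close> times \<open>\<bar>\<nabla>C\<bar>\<^sup>2 \<nabla>D - (\<nabla>C \<bullet> \<nabla>D) \<nabla>C\<close>.  It is tangent to the spheres
  \<open>C = const\<close>, so that \<open>C\<close> remains a first integral, and it points down the gradient of
  \<open>(D + k)\<^sup>2\<close> along them:
  \<open>D' = - \<epsilon> (D + k) W\<close>, where \<open>W = \<bar>\<nabla>C \<times> \<nabla>D\<bar>\<^sup>2 \<ge> 0\<close>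
  (\<open>monomial_integral_derivative\<close>).

  The four equilibria are the points with \<open>x\<^sup>2 = M\<^sup>2\<close>, \<open>y\<^sup>2 = l M\<^sup>2\<close>, \<open>z = 0\<close>.  By the weighted
  inequality between arithmetic and geometric means they are exactly the points of the sphere
  \<open>C = (l + 1) M\<^sup>2 / 2\<close> at which \<open>\<bar>D\<bar>\<close> attains its maximum \<open>\<bar>k\<bar>\<close>
  (\<open>extremal_iff_integrals\<close>).  An equilibrium \<open>e\<close> is stabilized by the perturbation whose sign is
  such that \<open>D(e) + k = 0\<close>; the two sign tables of the theorem only record the sign of \<open>D\<close> at the
  four points.

  For such an \<open>e\<close> put \<open>V = (C - C(e))\<^sup>2 + (D + k)\<^sup>2\<close>.  Its zeros are extremal points, hence
  isolated, and \<open>V' = - 2 \<epsilon> (D + k)\<^sup>2 W \<le> 0\<close> on the whole space.  This gives Lyapunov stability,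
  for the perturbed systems and, with \<open>\<epsilon> = 0\<close>, for the rattleback system itself, in all of
  \<open>\<real>\<^sup>3\<close>.  On the sphere and near \<open>e\<close>, the functions \<open>D + k\<close> and \<open>W\<close> vanish only at \<open>e\<close>, so that
  \<open>V\<close> decreases at a definite rate as long as a trajectory keeps away from \<open>e\<close>; since \<open>V \<ge> 0\<close>,
  it must come arbitrarily close to \<open>e\<close>, and stability then keeps it there.

  Trajectories exist for all forward times because the vector fields are polynomial, hence
  Lipschitz on balls, and orthogonal to the position vector, so that solutions cannot leave the
  sphere on which they start (\<open>norm_preserving_global_solution_exists\<close>).
\<close>

section \<open>Global existence of solutions\<close>

lemma integral_has_vector_derivative_atLeast:
  fixes f :: "real \<Rightarrow> 'a::banach"
  assumes "continuous_on {a..} f" and "a \<le> t"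
  shows "((\<lambda>t. integral {a..t} f) has_vector_derivative f t) (at t within {a..})"
proof -
  have "((\<lambda>t. integral {a..t} f) has_vector_derivative f t) (at t within {a..t + 1})"
    using assms by (intro integral_has_vector_derivative continuous_on_subset[OF assms(1)]) auto
  moreover have "at t within {a..t + 1} = at t within {a..}"
    by (rule at_within_nhd[where S = "{..<t + 1}"]) auto
  ultimately show ?thesis
    by simp
qed

text \<open>
  The weight \<open>exp (- c t)\<close> turns integration from \<open>0\<close> into an operator of norm at most \<open>1 / c\<close>
  on functions that grow at most like \<open>exp (c t)\<close>, uniformly in \<open>t\<close>.  This is what makes the
  Picard operator a contraction on the whole half-line at once.
\<close>

lemma norm_weighted_integral_le:
  fixes w :: "real \<Rightarrow> 'a::euclidean_space"
  assumes w: "continuous_on {0..t} w" and bound: "\<And>s. s \<in> {0..t} \<Longrightarrow> norm (w s) \<le> A * exp (c * s)"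
    and "0 < c" "0 \<le> t" "0 \<le> A"
  shows "norm (exp (- (c * t)) *\<^sub>R integral {0..t} w) \<le> A / c"
proof -
  have I: "((\<lambda>s. A * exp (c * s)) has_integral (A * exp (c * t) / c - A * exp (c * 0) / c)) {0..t}"
    using \<open>0 < c\<close> \<open>0 \<le> t\<close>
    by (intro fundamental_theorem_of_calculus)
       (auto intro!: derivative_eq_intros simp flip: has_real_derivative_iff_has_vector_derivative)
  have "norm (integral {0..t} w) \<le> integral {0..t} (\<lambda>s. A * exp (c * s))"
    using I w bound
    by (intro integral_norm_bound_integral integrable_continuous_interval)
       (auto intro!: continuous_intros)
  also have "\<dots> = A * exp (c * t) / c - A / c"
    using integral_unique[OF I] by simp
  also have "\<dots> \<le> A * exp (c * t) / c"
    using \<open>0 \<le> A\<close> \<open>0 < c\<close> by simp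
  finally have "norm (integral {0..t} w) \<le> A * exp (c * t) / c" .
  then have "exp (- (c * t)) * norm (integral {0..t} w) \<le> exp (- (c * t)) * (A * exp (c * t) / c)"
    by (intro mult_left_mono) auto
  also have "\<dots> = A / c"
    by (simp add: exp_minus)
  finally show ?thesis
    by simp
qed

text \<open>
  The Picard-Lindelof theorem with a globally Lipschitz right-hand side.  Writing
  \<open>\<gamma> t = p + exp (c t) u t\<close> with \<open>c\<close> twice the Lipschitz constant, the integral equation becomes
  a fixed-point equation for the bounded continuous function \<open>u\<close>, and the
  operator in it contracts distances by the factor \<open>1/2\<close>.
\<close>

lemma lipschitz_global_solution_exists:
  fixes g :: "'a::euclidean_space \<Rightarrow> 'a"
  assumes "L-lipschitz_on UNIV g"
  obtains \<gamma> where "\<gamma> 0 = p"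
    and "\<And>t. 0 \<le> t \<Longrightarrow> (\<gamma> has_vector_derivative g (\<gamma> t)) (at t within {0..})"
proof -
  \<comment> \<open>The Lipschitz constant is increased to make it positive.\<close>
  define K where "K = L + 1"
  have K: "K-lipschitz_on UNIV g" "0 < K"
    using lipschitz_on_mono[OF assms] lipschitz_on_nonneg[OF assms] by (auto simp: K_def)
  have g_cont: "continuous_on X g" for X
    using lipschitz_on_continuous_on[OF K(1)] continuous_on_subset by blast
  define c where "c = 2 * K"
  have c: "0 < c"
    using K(2) by (simp add: c_def)
  define w :: "(real \<Rightarrow>\<^sub>C 'a) \<Rightarrow> real \<Rightarrow> 'a"
    where "w u s = g (p + exp (c * s) *\<^sub>R u s)" for u s
  have w_cont: "continuous_on X (w u)" for X u
    unfolding w_def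
    by (rule continuous_on_compose2[OF g_cont[of UNIV]]) (auto intro!: continuous_intros)
  \<comment> \<open>Bounded continuous functions live on the whole line; negative times are clipped to \<open>0\<close>.\<close>
  define T :: "(real \<Rightarrow>\<^sub>C 'a) \<Rightarrow> real \<Rightarrow> 'a"
    where "T u t = exp (- (c * max 0 t)) *\<^sub>R integral {0..max 0 t} (w u)" for u t
  have T_mem: "T u \<in> bcontfun" for u
  proof -
    have "continuous_on {0..} (\<lambda>t. integral {0..t} (w u))"
      using integral_has_vector_derivative_atLeast[OF w_cont]
      by (intro continuous_on_vector_derivative) auto
    then have "continuous_on UNIV (\<lambda>t. integral {0..max 0 t} (w u))"
      by (rule continuous_on_compose2) (auto intro!: continuous_intros)
    then have "continuous_on UNIV (T u)"
      unfolding T_def by (intro continuous_intros)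
    moreover have "bounded (range (T u))"
    proof -
      obtain b where b: "\<And>s. norm (u s) \<le> b"
        using bounded_apply_bcontfun[of u] unfolding bounded_iff by auto
      have "norm (T u t) \<le> (norm (g p) + K * b) / c" for t
        unfolding T_def
      proof (rule norm_weighted_integral_le)
        fix s assume "s \<in> {0..max 0 t}"
        then have e: "1 \<le> exp (c * s)"
          using c by (auto split: if_splits simp: max_def)
        have "norm (w u s) \<le> norm (g p) + norm (w u s - g p)"
          by (metis add.commute diff_add_cancel norm_triangle_ineq)
        also have "norm (w u s - g p) \<le> K * norm (exp (c * s) *\<^sub>R u s)"
          using lipschitz_on_normD[OF K(1), of "p + exp (c * s) *\<^sub>R u s" p] by (simp add: w_def)
        also have "\<dots> \<le> K * (exp (c * s) * b)"
          using K(2) b by (intro mult_left_mono) auto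
        also have "norm (g p) \<le> norm (g p) * exp (c * s)"
          using e by (simp add: mult_le_cancel_left1)
        finally show "norm (w u s) \<le> (norm (g p) + K * b) * exp (c * s)"
          by (simp add: algebra_simps)
      next
        have "0 \<le> b" using b[of 0] norm_ge_zero order_trans by blast
        then show "0 \<le> norm (g p) + K * b"
          using K(2) by simp
      qed (use c w_cont in auto)
      then show ?thesis
        unfolding bounded_iff by blast
    qed
    ultimately show ?thesis
      by (simp add: bcontfun_def)
  qed
  have T_apply: "apply_bcontfun (Bcontfun (T u)) t = T u t" for u t
    by (simp add: Bcontfun_inverse T_mem)
  have "dist (Bcontfun (T u)) (Bcontfun (T v)) \<le> 1 / 2 * dist u v" for u v
  proof (rule dist_bound)
    fix t :: real
    define \<tau> where "\<tau> = max 0 t"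
    have int: "w x integrable_on {0..\<tau>}" for x
      by (intro integrable_continuous_interval w_cont)
    have "T u t - T v t = exp (- (c * \<tau>)) *\<^sub>R integral {0..\<tau>} (\<lambda>s. w u s - w v s)"
      by (simp add: T_def \<tau>_def[symmetric] integral_diff[OF int int] scaleR_diff_right)
    moreover have "norm (exp (- (c * \<tau>)) *\<^sub>R integral {0..\<tau>} (\<lambda>s. w u s - w v s)) \<le> (K * dist u v) / c"
    proof (rule norm_weighted_integral_le)
      fix s
      have "norm (w u s - w v s) \<le> K * norm (exp (c * s) *\<^sub>R (u s - v s))"
        using lipschitz_on_normD[OF K(1), of "p + exp (c * s) *\<^sub>R u s" "p + exp (c * s) *\<^sub>R v s"]
        by (simp add: w_def scaleR_diff_right)
      also have "\<dots> \<le> K * (exp (c * s) * dist u v)"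
        using K(2) dist_bounded[of u s v] by (intro mult_left_mono) (auto simp: dist_norm)
      finally show "norm (w u s - w v s) \<le> K * dist u v * exp (c * s)"
        by (simp add: mult_ac)
    qed (use K c in \<open>auto intro!: continuous_intros w_cont simp: \<tau>_def\<close>)
    ultimately show "dist (Bcontfun (T u) t) (Bcontfun (T v) t) \<le> 1 / 2 * dist u v"
      using K(2) by (simp add: T_apply dist_norm c_def)
  qed
  then have "\<exists>!u. Bcontfun (T u) = u"
    by (intro banach_fix_type[where c = "1/2"]) auto
  then obtain u where "Bcontfun (T u) = u"
    by blast
  then have u: "u t = T u t" for t
    using T_apply by metis
  define \<gamma> where "\<gamma> t = p + exp (c * t) *\<^sub>R u t" for t
  have \<gamma>: "\<gamma> t = p + integral {0..t} (w u)" if "0 \<le> t" for t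
    using that u[of t] by (simp add: \<gamma>_def T_def max_def exp_minus)
  have "(\<gamma> has_vector_derivative g (\<gamma> t)) (at t within {0..})" if "0 \<le> t" for t
  proof (rule has_vector_derivative_transform)
    show "((\<lambda>t. p + integral {0..t} (w u)) has_vector_derivative g (\<gamma> t)) (at t within {0..})"
      using integral_has_vector_derivative_atLeast[OF w_cont[of _ u] that]
      by (auto intro!: derivative_eq_intros simp: w_def \<gamma>_def)
  qed (use that \<gamma> in auto)
  then show thesis
    using \<gamma>[of 0] that[of \<gamma>] by simp
qed

text \<open>
  If the field is orthogonal to the position vector, it may be truncated: composing it with the
  nearest-point projection \<open>\<rho>\<close> onto a ball makes it globally Lipschitz.  As \<open>\<rho>\<close> moves points along
  rays, the truncated field is still orthogonal to the position vector, so its solutions keep their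
  norm, never leave the ball in which they start and therefore solve the original equation.
\<close>

lemma norm_preserving_global_solution_exists:
  fixes f :: "'a::euclidean_space \<Rightarrow> 'a"
  assumes lip: "\<And>r. \<exists>L. L-lipschitz_on (cball 0 r) f" and orth: "\<And>x. x \<bullet> f x = 0"
  obtains \<gamma> where "\<gamma> 0 = p"
    and "\<And>t. 0 \<le> t \<Longrightarrow> (\<gamma> has_vector_derivative f (\<gamma> t)) (at t within {0..})"
proof -
  \<comment> \<open>The summand \<open>1\<close> makes the radius positive even for \<open>p = 0\<close>.\<close>
  define r where "r = norm p + 1"
  have r: "0 < r" "norm p < r"
    using norm_ge_zero[of p] by (auto simp: r_def simp del: norm_ge_zero)
  define \<rho> :: "'a \<Rightarrow> 'a" where "\<rho> = closest_point (cball 0 r)"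
  have \<rho>_inside: "\<rho> x = x" if "norm x \<le> r" for x
    using that by (simp add: \<rho>_def closest_point_self)
  have \<rho>_radial: "\<exists>s>0. \<rho> x = s *\<^sub>R x" for x
  proof (cases "norm x \<le> r")
    case True
    then show ?thesis by (auto simp: \<rho>_inside intro!: exI[of _ 1])
  next
    case False
    then have x: "0 < norm x" "r < norm x" using r by auto
    have "norm (x - (r / norm x) *\<^sub>R x) = norm x - r"
    proof -
      have "x - (r / norm x) *\<^sub>R x = (1 - r / norm x) *\<^sub>R x"
        by (simp add: algebra_simps)
      then have "norm (x - (r / norm x) *\<^sub>R x) = \<bar>1 - r / norm x\<bar> * norm x"
        by simp
      also have "\<dots> = norm x - r"
        using x by (simp add: abs_if field_simps)
      finally show ?thesis .
    qed
    moreover have "norm x - r \<le> norm (x - z)" if "norm z \<le> r" for z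
      using norm_triangle_ineq2[of x z] that by simp
    ultimately have "(r / norm x) *\<^sub>R x = \<rho> x"
      unfolding \<rho>_def using r x by (intro closest_point_unique) (auto simp: dist_norm)
    then show ?thesis
      using r x by (intro exI[of _ "r / norm x"]) auto
  qed
  obtain L where L: "L-lipschitz_on (cball 0 r) f"
    using lip by blast
  have "(L * 1)-lipschitz_on UNIV (f \<circ> \<rho>)"
  proof (rule lipschitz_on_compose)
    show "1-lipschitz_on UNIV \<rho>"
      using r by (auto intro!: lipschitz_onI closest_point_lipschitz simp: \<rho>_def)
    have "range \<rho> \<subseteq> cball 0 r"
      using r closest_point_in_set[of "cball 0 r"] by (auto simp: \<rho>_def)
    then show "L-lipschitz_on (range \<rho>) f"
      using L lipschitz_on_subset by blast
  qed
  then obtain \<gamma> where \<gamma>: "\<gamma> 0 = p"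
    "\<And>t. 0 \<le> t \<Longrightarrow> (\<gamma> has_vector_derivative (f \<circ> \<rho>) (\<gamma> t)) (at t within {0..})"
    using lipschitz_global_solution_exists by blast
  have orth': "x \<bullet> f (\<rho> x) = 0" for x
  proof -
    obtain s where "s > 0" "\<rho> x = s *\<^sub>R x"
      using \<rho>_radial by blast
    then show ?thesis
      using orth[of "\<rho> x"] by simp
  qed
  have "((\<lambda>t. \<gamma> t \<bullet> \<gamma> t) has_vector_derivative 0) (at t within {0..})" if "t \<in> {0..}" for t
    using bounded_bilinear.has_vector_derivative[OF bounded_bilinear_inner \<gamma>(2) \<gamma>(2), of t] that orth'[of "\<gamma> t"]
    by (simp add: inner_commute)
  then obtain k where "\<And>t. t \<in> {0..} \<Longrightarrow> \<gamma> t \<bullet> \<gamma> t = k"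
    using has_vector_derivative_zero_constant[of "{0::real..}" "\<lambda>t. \<gamma> t \<bullet> \<gamma> t"] by auto
  then have "norm (\<gamma> t) = norm p" if "0 \<le> t" for t
    using that \<gamma>(1) by (metis atLeast_iff norm_eq order_refl)
  then have "\<rho> (\<gamma> t) = \<gamma> t" if "0 \<le> t" for t
    using that r by (simp add: \<rho>_inside)
  then show thesis
    using \<gamma> that[of \<gamma>] by simp
qed

section \<open>Lyapunov functions\<close>

lemma forward_trajectory_has_vector_derivative:
  assumes "forward_trajectory f p \<gamma>" "0 \<le> t"
  shows "(\<gamma> has_vector_derivative f (\<gamma> t)) (at t within {0..})"
  using assms by (simp add: forward_trajectory_def solves_def)

lemma forward_trajectory_continuous_on:
  assumes "forward_trajectory f p \<gamma>"
  shows "continuous_on {0..} \<gamma>"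
  using forward_trajectory_has_vector_derivative[OF assms]
  by (intro continuous_on_vector_derivative) auto

lemma forward_trajectory_shift:
  assumes "forward_trajectory f p \<gamma>" "0 \<le> s"
  shows "forward_trajectory f (\<gamma> s) (\<lambda>t. \<gamma> (s + t))"
proof -
  have "((\<lambda>t. \<gamma> (s + t)) has_vector_derivative f (\<gamma> (s + t))) (at t within {0..})" if "0 \<le> t" for t
  proof -
    have "(\<gamma> has_vector_derivative f (\<gamma> (s + t))) (at (s + t) within (\<lambda>t. s + t) ` {0..})"
      using assms(2) that
      by (intro has_vector_derivative_within_subset[OF forward_trajectory_has_vector_derivative[OF assms(1)]])
         auto
    then have "((\<gamma> \<circ> (\<lambda>t. s + t)) has_vector_derivative 1 *\<^sub>R f (\<gamma> (s + t))) (at t within {0..})"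
      by (intro vector_diff_chain_within) (auto intro!: derivative_eq_intros)
    then show ?thesis
      by (simp add: o_def)
  qed
  then show ?thesis
    by (auto simp: forward_trajectory_def solves_def)
qed

text \<open>
  The derivative at \<open>a\<close> is one-sided, as for trajectories at time \<open>0\<close>; only the open interval
  enters the mean value theorem.
\<close>

lemma nonincreasing_of_nonpos_derivative:
  fixes h :: "real \<Rightarrow> real"
  assumes deriv: "\<And>t. a \<le> t \<Longrightarrow> (h has_real_derivative h' t) (at t within {a..})"
    and nonpos: "\<And>t. a \<le> t \<Longrightarrow> t \<le> b \<Longrightarrow> h' t \<le> 0" and "a \<le> b"
  shows "h b \<le> h a"
proof (rule DERIV_nonpos_imp_decreasing_open[OF \<open>a \<le> b\<close>])
  fix t assume "a < t" "t < b"
  then have "at t within {a..} = at t"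
    by (intro at_within_interior) auto
  then show "\<exists>y. (h has_real_derivative y) (at t) \<and> y \<le> 0"
    using deriv[of t] nonpos[of t] \<open>a < t\<close> \<open>t < b\<close> by auto
next
  have "continuous_on {a..} h"
    using deriv by (intro DERIV_continuous_on) auto
  then show "continuous_on {a..b} h"
    by (rule continuous_on_subset) auto
qed

text \<open>
  The minimum of \<open>F\<close> on a small sphere around \<open>e\<close> is a barrier: a trajectory that starts close
  enough to \<open>e\<close> for \<open>F\<close> to be below it could cross the sphere only by increasing \<open>F\<close>.
\<close>

lemma lyapunov_function_imp_stable:
  fixes F :: "real^3 \<Rightarrow> real"
  assumes ex: "\<And>p. \<exists>\<gamma>. forward_trajectory f p \<gamma>"
    and decr: "\<And>p \<gamma> t. forward_trajectory f p \<gamma> \<Longrightarrow> 0 \<le> t \<Longrightarrow> F (\<gamma> t) \<le> F p"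
    and cont: "continuous_on UNIV F" and "F e = 0" and "0 < r"
    and pos: "\<And>q. q \<in> cball e r \<Longrightarrow> q \<noteq> e \<Longrightarrow> 0 < F q"
  shows "lyapunov_stable_on f UNIV e"
  unfolding lyapunov_stable_on_def
proof (intro allI impI)
  fix \<eta> :: real assume "0 < \<eta>"
  define \<rho> where "\<rho> = min \<eta> r"
  have \<rho>: "0 < \<rho>" "\<rho> \<le> \<eta>" "\<rho> \<le> r"
    using \<open>0 < \<eta>\<close> \<open>0 < r\<close> by (auto simp: \<rho>_def)
  have "\<exists>q\<in>sphere e \<rho>. \<forall>q'\<in>sphere e \<rho>. F q \<le> F q'"
    using \<rho> by (intro continuous_attains_inf continuous_on_subset[OF cont]) auto
  then obtain q where q: "dist e q = \<rho>" and barrier: "\<And>q'. dist e q' = \<rho> \<Longrightarrow> F q \<le> F q'"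
    by auto
  have "0 < F q"
    using q \<rho> by (intro pos) auto
  then have "open {p. F p < F q}" "e \<in> {p. F p < F q}"
    using \<open>F e = 0\<close> cont by (auto intro!: open_Collect_less continuous_intros)
  then obtain \<delta> where \<delta>: "0 < \<delta>" "\<And>p. dist p e < \<delta> \<Longrightarrow> F p < F q"
    unfolding open_dist by blast
  have "dist (\<gamma> t) e < \<eta>"
    if p: "dist p e < min \<delta> \<rho>" and \<gamma>: "forward_trajectory f p \<gamma>" and "0 \<le> t" for p \<gamma> t
  proof (rule ccontr)
    assume "\<not> dist (\<gamma> t) e < \<eta>"
    moreover have "continuous_on {0..t} (\<lambda>s. dist (\<gamma> s) e)"
      by (intro continuous_intros continuous_on_subset[OF forward_trajectory_continuous_on[OF \<gamma>]]) auto
    moreover have "\<gamma> 0 = p"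
      using \<gamma> by (simp add: forward_trajectory_def)
    ultimately obtain s where s: "0 \<le> s" "dist (\<gamma> s) e = \<rho>"
      using IVT'[of "\<lambda>s. dist (\<gamma> s) e" 0 \<rho> t] p \<rho> \<open>0 \<le> t\<close> by auto
    then have "F q \<le> F (\<gamma> s)"
      by (intro barrier) (simp add: dist_commute)
    also have "\<dots> \<le> F p"
      using decr \<gamma> s by blast
    also have "\<dots> < F q"
      using \<delta>(2) p by simp
    finally show False by simp
  qed
  then show "\<exists>\<delta>>0. \<forall>p\<in>UNIV. dist p e < \<delta> \<longrightarrow>
      trajectory_satisfies f p (\<lambda>\<gamma>. \<forall>t\<ge>0. dist (\<gamma> t) e < \<eta>)"
    using \<delta>(1) \<rho>(1) ex by (intro exI[of _ "min \<delta> \<rho>"]) (auto simp: trajectory_satisfies_def)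
qed

lemma lyapunov_stable_on_subset:
  assumes "lyapunov_stable_on f T e" "S \<subseteq> T"
  shows "lyapunov_stable_on f S e"
  using assms unfolding lyapunov_stable_on_def by (meson subset_iff)

text \<open>
  Given stability, attraction only requires that a trajectory enters every neighbourhood of \<open>e\<close>
  once, since from then on stability confines it.  If it kept outside some \<open>\<delta>'\<close>-ball, it would
  stay in a compact set on which the rate of decrease \<open>G\<close> has a positive minimum, and \<open>F\<close> would
  become negative.
\<close>

lemma strict_lyapunov_function_imp_attracting:
  fixes F G :: "real^3 \<Rightarrow> real"
  assumes stable: "lyapunov_stable_on f S e" and inv: "invariant_set f S" and "closed S"
    and deriv: "\<And>p \<gamma> t. forward_trajectory f p \<gamma> \<Longrightarrow> 0 \<le> t \<Longrightarrow>
      ((\<lambda>t. F (\<gamma> t)) has_real_derivative - G (\<gamma> t)) (at t within {0..})"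
    and nonneg: "\<And>q. 0 \<le> F q" and G_cont: "continuous_on UNIV G" and "0 < r"
    and pos: "\<And>q. q \<in> S \<Longrightarrow> q \<in> cball e r \<Longrightarrow> q \<noteq> e \<Longrightarrow> 0 < G q"
  shows "locally_attracting_on f S e"
proof -
  have stays: "\<gamma> t \<in> S" if "forward_trajectory f p \<gamma>" "p \<in> S" "0 \<le> t" for p \<gamma> t
    using inv that unfolding invariant_set_def forward_trajectory_def
    by (metis atLeast_iff is_interval_ci order_refl)
  obtain \<delta> where "0 < \<delta>" and \<delta>: "\<And>p. p \<in> S \<Longrightarrow> dist p e < \<delta> \<Longrightarrow>
      trajectory_satisfies f p (\<lambda>\<gamma>. \<forall>t\<ge>0. dist (\<gamma> t) e < r)"
    using stable \<open>0 < r\<close> unfolding lyapunov_stable_on_def by blast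
  have "(\<gamma> \<longlongrightarrow> e) at_top"
    if "p \<in> S" "dist p e < \<delta>" and \<gamma>: "forward_trajectory f p \<gamma>" for p \<gamma>
  proof (rule tendstoI)
    fix \<eta> :: real assume "0 < \<eta>"
    then obtain \<delta>' where "0 < \<delta>'" and \<delta>': "\<And>p. p \<in> S \<Longrightarrow> dist p e < \<delta>' \<Longrightarrow>
        trajectory_satisfies f p (\<lambda>\<gamma>. \<forall>t\<ge>0. dist (\<gamma> t) e < \<eta>)"
      using stable unfolding lyapunov_stable_on_def by blast
    have "\<exists>s\<ge>0. dist (\<gamma> s) e < \<delta>'"
    proof (rule ccontr)
      assume "\<not> (\<exists>s\<ge>0. dist (\<gamma> s) e < \<delta>')"
      then have far: "\<delta>' \<le> dist (\<gamma> t) e" if "0 \<le> t" for t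
        using that by force
      define A where "A = S \<inter> cball e r - ball e \<delta>'"
      have \<gamma>_A: "\<gamma> t \<in> A" if "0 \<le> t" for t
        using far[OF that] stays[OF \<gamma> \<open>p \<in> S\<close> that] \<delta>[OF \<open>p \<in> S\<close> \<open>dist p e < \<delta>\<close>] \<gamma> that
        by (force simp: A_def trajectory_satisfies_def dist_commute)
      have "compact A"
        unfolding A_def using \<open>closed S\<close> by (intro compact_diff closed_Int_compact) auto
      then obtain q where q: "q \<in> A" "\<And>q'. q' \<in> A \<Longrightarrow> G q \<le> G q'"
        using continuous_attains_inf[of A G] \<gamma>_A[of 0] continuous_on_subset[OF G_cont, of A] by auto
      have "0 < G q"
        using q(1) \<open>0 < \<delta>'\<close> by (intro pos) (auto simp: A_def)
      \<comment> \<open>At this time a decrease at rate \<open>G q\<close> has used up more than the initial value \<open>F p\<close>.\<close>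
      define T where "T = F p / G q + 1"
      have T: "0 \<le> T"
        using nonneg[of p] \<open>0 < G q\<close> by (simp add: T_def)
      have "F (\<gamma> T) + G q * T \<le> F (\<gamma> 0) + G q * 0"
      proof (rule nonincreasing_of_nonpos_derivative[where h = "\<lambda>t. F (\<gamma> t) + G q * t"])
        fix t :: real assume "0 \<le> t"
        then show "((\<lambda>t. F (\<gamma> t) + G q * t) has_real_derivative - G (\<gamma> t) + G q) (at t within {0..})"
          by (auto intro!: derivative_eq_intros deriv[OF \<gamma>])
        show "- G (\<gamma> t) + G q \<le> 0"
          using q(2) \<gamma>_A \<open>0 \<le> t\<close> by simp
      qed (use T in auto)
      moreover have "G q * T = F p + G q"
        using \<open>0 < G q\<close> by (simp add: T_def field_simps)
      moreover have "\<gamma> 0 = p"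
        using \<gamma> by (simp add: forward_trajectory_def)
      ultimately show False
        using nonneg[of "\<gamma> T"] \<open>0 < G q\<close> by simp
    qed
    then obtain s where s: "0 \<le> s" "dist (\<gamma> s) e < \<delta>'"
      by blast
    have "dist (\<gamma> (s + t)) e < \<eta>" if "0 \<le> t" for t
      using \<delta>'[OF stays[OF \<gamma> \<open>p \<in> S\<close> s(1)] s(2)] forward_trajectory_shift[OF \<gamma> s(1)] that
      by (auto simp: trajectory_satisfies_def)
    from this[of "t - s" for t] have "\<forall>t\<ge>s. dist (\<gamma> t) e < \<eta>"
      by simp
    then show "\<forall>\<^sub>F t in at_top. dist (\<gamma> t) e < \<eta>"
      unfolding eventually_at_top_linorder by blast
  qed
  then show ?thesis
    unfolding locally_attracting_on_def
    using \<open>0 < \<delta>\<close> \<delta> by (auto simp: trajectory_satisfies_def intro!: exI[of _ \<delta>])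
qed

section \<open>Lipschitz continuity of polynomial maps on bounded sets\<close>

lemma lipschitz_on_mult_bounded:
  fixes f g :: "'a::metric_space \<Rightarrow> real"
  assumes f: "\<exists>L. L-lipschitz_on X f" and g: "\<exists>L. L-lipschitz_on X g" and "bounded X"
  shows "\<exists>L. L-lipschitz_on X (\<lambda>x. f x * g x)"
proof -
  have bdd: "\<exists>B>0. \<forall>x\<in>X. \<bar>h x\<bar> \<le> B" if h: "\<exists>L. L-lipschitz_on X h" for h :: "'a \<Rightarrow> real"
  proof -
    obtain L where L: "L-lipschitz_on X h"
      using h by blast
    obtain d where d: "\<And>x y. x \<in> X \<Longrightarrow> y \<in> X \<Longrightarrow> dist x y \<le> d"
      using \<open>bounded X\<close> by (meson bounded_two_points)
    show ?thesis
    proof (cases "X = {}")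
      case False
      then obtain a where "a \<in> X" by blast
      have "\<bar>h x\<bar> \<le> \<bar>h a\<bar> + L * d + 1" if "x \<in> X" for x
      proof -
        have "dist (h x) (h a) \<le> L * d"
          using lipschitz_onD[OF L that \<open>a \<in> X\<close>] d[OF that \<open>a \<in> X\<close>] lipschitz_on_nonneg[OF L]
          by (meson mult_left_mono order_trans)
        then show ?thesis
          by (simp add: dist_real_def)
      qed
      moreover have "0 \<le> L * d"
        using d[OF \<open>a \<in> X\<close> \<open>a \<in> X\<close>] lipschitz_on_nonneg[OF L] by simp
      ultimately show ?thesis
        by (intro exI[of _ "\<bar>h a\<bar> + L * d + 1"]) auto
    qed (auto intro: exI[of _ 1])
  qed
  obtain A where A: "A > 0" "\<And>x. x \<in> X \<Longrightarrow> \<bar>f x\<bar> \<le> A" using bdd[OF f] by blast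
  obtain B where B: "B > 0" "\<And>x. x \<in> X \<Longrightarrow> \<bar>g x\<bar> \<le> B" using bdd[OF g] by blast
  obtain L M where L: "L-lipschitz_on X f" and M: "M-lipschitz_on X g" using f g by blast
  have "(A * M + B * L)-lipschitz_on X (\<lambda>x. f x * g x)"
  proof (rule lipschitz_onI)
    fix x y assume xy: "x \<in> X" "y \<in> X"
    have "\<bar>f x * g x - f y * g y\<bar> = \<bar>f x * (g x - g y) + g y * (f x - f y)\<bar>"
      by (simp add: algebra_simps)
    also have "\<dots> \<le> \<bar>f x\<bar> * \<bar>g x - g y\<bar> + \<bar>g y\<bar> * \<bar>f x - f y\<bar>"
      by (metis abs_mult abs_triangle_ineq)
    also have "\<dots> \<le> A * (M * dist x y) + B * (L * dist x y)"
      using A B xy lipschitz_onD[OF L xy] lipschitz_onD[OF M xy]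
      by (intro add_mono mult_mono) (auto simp: dist_real_def)
    finally show "dist (f x * g x) (f y * g y) \<le> (A * M + B * L) * dist x y"
      by (simp add: dist_real_def algebra_simps)
  qed (use A B lipschitz_on_nonneg[OF L] lipschitz_on_nonneg[OF M] in auto)
  then show ?thesis ..
qed

lemma lipschitz_on_power_bounded:
  fixes f :: "'a::metric_space \<Rightarrow> real"
  assumes "\<exists>L. L-lipschitz_on X f" and "bounded X"
  shows "\<exists>L. L-lipschitz_on X (\<lambda>x. f x ^ n)"
proof (induction n)
  case 0
  show ?case using lipschitz_on_constant[of X 1] by (simp only: power_0) (rule exI)
next
  case (Suc n)
  show ?case
    unfolding power_Suc by (rule lipschitz_on_mult_bounded[OF assms(1) Suc.IH assms(2)])
qed

lemma lipschitz_on_componentwise: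
  fixes f :: "'a::metric_space \<Rightarrow> real^'n"
  assumes "\<And>i. \<exists>L. L-lipschitz_on X (\<lambda>x. f x $ i)"
  shows "\<exists>L. L-lipschitz_on X f"
proof -
  obtain L where L: "\<And>i. (L i)-lipschitz_on X (\<lambda>x. f x $ i)"
    using assms by metis
  have "(\<Sum>i\<in>UNIV. L i)-lipschitz_on X f"
  proof (rule lipschitz_onI)
    fix x y assume xy: "x \<in> X" "y \<in> X"
    have "dist (f x) (f y) \<le> (\<Sum>i\<in>UNIV. \<bar>(f x - f y) $ i\<bar>)"
      unfolding dist_norm by (rule norm_le_l1_cart)
    also have "\<dots> \<le> (\<Sum>i\<in>UNIV. L i * dist x y)"
      using lipschitz_onD[OF L xy] by (intro sum_mono) (simp add: dist_real_def)
    finally show "dist (f x) (f y) \<le> (\<Sum>i\<in>UNIV. L i) * dist x y"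
      by (simp add: sum_distrib_right)
  qed (use lipschitz_on_nonneg[OF L] in \<open>auto intro: sum_nonneg\<close>)
  then show ?thesis ..
qed

lemma lipschitz_on_component:
  "\<exists>L. L-lipschitz_on X (\<lambda>x::real^'n. x $ i)"
proof
  show "1-lipschitz_on X (\<lambda>x::real^'n. x $ i)"
    by (rule lipschitz_onI) (auto simp: dist_vec_nth_le)
qed

section \<open>First integrals of the rattleback system and its perturbations\<close>

definition monomial_integral :: "nat \<Rightarrow> real^3 \<Rightarrow> real" where
  "monomial_integral l q = q$1 * q$2 ^ l"

text \<open>
  For \<open>l > 0\<close>, the Gram determinant of \<open>\<nabla>C = (x, y, z)\<close> and \<open>\<nabla>D = y ^ (l - 1) (y, l x, 0)\<close>, that is, the
  squared length of their cross product.  It vanishes exactly where the two gradients are linearly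
  dependent.
\<close>

definition gram_det :: "nat \<Rightarrow> real^3 \<Rightarrow> real" where
  "gram_det l q = (q$2 ^ (l - 1))\<^sup>2 *
    ((real l * (q$1)\<^sup>2 - (q$2)\<^sup>2)\<^sup>2 + (q$3)\<^sup>2 * ((q$2)\<^sup>2 + (real l)\<^sup>2 * (q$1)\<^sup>2))"

text \<open>
  The constant \<open>k\<close> in the perturbation.  Its absolute value, for \<open>\<sigma> = \<plusminus>1\<close>, is the maximum of
  \<open>\<bar>D\<bar>\<close> on the sphere through the equilibria.
\<close>

definition offset :: "real \<Rightarrow> nat \<Rightarrow> real \<Rightarrow> real" where
  "offset \<sigma> l M = \<sigma> * (\<bar>M\<bar> ^ (l + 1) * sqrt (real l) ^ l)"

lemma perturbed_components:
  fixes q :: "real^3"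
  shows "perturbed \<sigma> l \<epsilon> M q $ 1 = real l * q$1 * q$3 +
      \<epsilon> * (monomial_integral l q + offset \<sigma> l M) * q$2 ^ (l - 1) *
      (q$2 * (real l * (q$1)\<^sup>2 - (q$2)\<^sup>2 - (q$3)\<^sup>2))"
    and "perturbed \<sigma> l \<epsilon> M q $ 2 = - q$2 * q$3 +
      \<epsilon> * (monomial_integral l q + offset \<sigma> l M) * q$2 ^ (l - 1) *
      (q$1 * (- real l * (q$1)\<^sup>2 + (q$2)\<^sup>2 - real l * (q$3)\<^sup>2))"
    and "perturbed \<sigma> l \<epsilon> M q $ 3 = (q$2)\<^sup>2 - real l * (q$1)\<^sup>2 +
      \<epsilon> * (monomial_integral l q + offset \<sigma> l M) * q$2 ^ (l - 1) *
      ((real l + 1) * q$1 * q$2 * q$3)"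
  unfolding perturbed_def rattleback_def Let_def monomial_integral_def offset_def
    vector_add_component vector_scaleR_component vector_3 real_scaleR_def
  by (rule refl)+

text \<open>
  Treating the rattleback system as the degenerate case \<open>\<epsilon> = 0\<close> lets existence, invariance and
  Lyapunov stability be proved once for both kinds of systems.
\<close>

lemma rattleback_eq_perturbed: "rattleback l = perturbed \<sigma> l 0 M"
  by (auto simp: perturbed_def Let_def)

lemma perturbed_orthogonal: "q \<bullet> perturbed \<sigma> l \<epsilon> M q = 0"
  unfolding inner_vec_def sum_3 perturbed_components
  by simp algebra

lemma perturbed_lipschitz: "\<exists>L. L-lipschitz_on (cball 0 r) (perturbed \<sigma> l \<epsilon> M)"
proof (rule lipschitz_on_componentwise)
  have add: "\<exists>L. L-lipschitz_on X (\<lambda>x. f x + g x)"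
    if "\<exists>L. L-lipschitz_on X f" "\<exists>L. L-lipschitz_on X g" for X :: "(real^3) set" and f g :: "_ \<Rightarrow> real"
    using that lipschitz_on_add by blast
  have diff: "\<exists>L. L-lipschitz_on X (\<lambda>x. f x - g x)"
    if "\<exists>L. L-lipschitz_on X f" "\<exists>L. L-lipschitz_on X g" for X :: "(real^3) set" and f g :: "_ \<Rightarrow> real"
    using that lipschitz_on_diff by blast
  have minus: "\<exists>L. L-lipschitz_on X (\<lambda>x. - f x)"
    if "\<exists>L. L-lipschitz_on X f" for X :: "(real^3) set" and f :: "_ \<Rightarrow> real"
    using that lipschitz_on_minus by blast
  have const: "\<exists>L. L-lipschitz_on X (\<lambda>x. k)" for X :: "(real^3) set" and k :: real
    using lipschitz_on_constant by blast
  fix i :: 3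
  have "i = 1 \<or> i = 2 \<or> i = 3"
    by (rule exhaust_3)
  then show "\<exists>L. L-lipschitz_on (cball 0 r) (\<lambda>q. perturbed \<sigma> l \<epsilon> M q $ i)"
    by (elim disjE; simp only: perturbed_components monomial_integral_def;
        intro add diff minus const lipschitz_on_mult_bounded lipschitz_on_power_bounded
          lipschitz_on_component bounded_cball)
qed

lemma perturbed_forward_trajectory_exists: "\<exists>\<gamma>. forward_trajectory (perturbed \<sigma> l \<epsilon> M) p \<gamma>"
proof -
  obtain \<gamma> where "\<gamma> 0 = p" "\<And>t. 0 \<le> t \<Longrightarrow>
      (\<gamma> has_vector_derivative perturbed \<sigma> l \<epsilon> M (\<gamma> t)) (at t within {0..})"
    using norm_preserving_global_solution_exists[OF perturbed_lipschitz perturbed_orthogonal] by metis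
  then show ?thesis
    by (auto simp: forward_trajectory_def solves_def)
qed

lemma has_real_derivative_component:
  fixes \<gamma> :: "real \<Rightarrow> real^'n"
  assumes "(\<gamma> has_vector_derivative v) F"
  shows "((\<lambda>t. \<gamma> t $ i) has_real_derivative v $ i) F"
  using bounded_linear.has_vector_derivative[OF bounded_linear_vec_nth assms]
  by (simp add: has_real_derivative_iff_has_vector_derivative)

lemma casimir_derivative:
  assumes "(\<gamma> has_vector_derivative perturbed \<sigma> l \<epsilon> M (\<gamma> t)) (at t within I)"
  shows "((\<lambda>t. casimir (\<gamma> t)) has_real_derivative 0) (at t within I)"
proof -
  note d = has_real_derivative_component[OF assms]
  have "((\<lambda>t. casimir (\<gamma> t)) has_real_derivative \<gamma> t \<bullet> perturbed \<sigma> l \<epsilon> M (\<gamma> t)) (at t within I)"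
    unfolding casimir_def inner_vec_def sum_3
    by (auto intro!: derivative_eq_intros d simp: field_simps)
  then show ?thesis
    by (simp add: perturbed_orthogonal)
qed

text \<open>
  The rattleback part contributes nothing since \<open>D\<close> is one of its first integrals.  Along
  \<open>- (\<bar>\<nabla>C\<bar>\<^sup>2 \<nabla>D - (\<nabla>C \<bullet> \<nabla>D) \<nabla>C)\<close> the derivative of \<open>D\<close> is
  \<open>- (\<bar>\<nabla>C\<bar>\<^sup>2 \<bar>\<nabla>D\<bar>\<^sup>2 - (\<nabla>C \<bullet> \<nabla>D)\<^sup>2)\<close>, the negative of the Gram determinant.
\<close>

lemma monomial_integral_derivative:
  assumes "0 < l"
    and "(\<gamma> has_vector_derivative perturbed \<sigma> l \<epsilon> M (\<gamma> t)) (at t within I)"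
  shows "((\<lambda>t. monomial_integral l (\<gamma> t)) has_real_derivative
    - \<epsilon> * (monomial_integral l (\<gamma> t) + offset \<sigma> l M) * gram_det l (\<gamma> t)) (at t within I)"
proof -
  obtain n where l: "l = Suc n"
    using \<open>0 < l\<close> gr0_implies_Suc by blast
  note d = has_real_derivative_component[OF assms(2)]
  let ?q = "\<gamma> t" and ?v = "perturbed \<sigma> l \<epsilon> M (\<gamma> t)"
  have "((\<lambda>t. monomial_integral l (\<gamma> t)) has_real_derivative
      ?v$1 * (?q$2 * ?q$2 ^ n) + ?q$1 * (real l * ?q$2 ^ n * ?v$2)) (at t within I)"
    using DERIV_mult[OF d[of 1] DERIV_power_Suc[OF d[of 2], of n]]
    by (simp add: monomial_integral_def l mult_ac)
  moreover have "?v$1 * (?q$2 * ?q$2 ^ n) + ?q$1 * (real l * ?q$2 ^ n * ?v$2) =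
      - \<epsilon> * (monomial_integral l (\<gamma> t) + offset \<sigma> l M) * gram_det l (\<gamma> t)"
  proof -
    define k where "k = monomial_integral l ?q + offset \<sigma> l M"
    \<comment> \<open>With this power abstracted, the claim is a polynomial identity in fixed degree.\<close>
    define w where "w = ?q$2 ^ n"
    show ?thesis
      unfolding perturbed_components k_def[symmetric] gram_det_def
      by (simp add: l flip: w_def) algebra
  qed
  ultimately show ?thesis
    by simp
qed

lemma invariant_casimir_level: "invariant_set (perturbed \<sigma> l \<epsilon> M) (casimir -` {c})"
  unfolding invariant_set_def
proof (intro allI impI, elim conjE bexE, intro ballI)
  fix I \<gamma> s t
  assume I: "is_interval I" and \<gamma>: "solves (perturbed \<sigma> l \<epsilon> M) I \<gamma>"
    and s: "s \<in> I" "\<gamma> s \<in> casimir -` {c}" and t: "t \<in> I"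
  have "\<exists>k. \<forall>t\<in>I. casimir (\<gamma> t) = k"
    using I \<gamma> casimir_derivative
    by (intro has_field_derivative_zero_constant) (auto simp: solves_def is_interval_convex)
  with s t show "\<gamma> t \<in> casimir -` {c}"
    by auto
qed

section \<open>The equilibria as extremal points\<close>

text \<open>
  The equality case of the weighted inequality between arithmetic and geometric means.  Taking
  logarithms, \<open>0 = ln u + l ln v \<le> (u - 1) + l (v - 1) \<le> 0\<close>, so the tangent line bound
  \<open>ln x \<le> x - 1\<close> is sharp at \<open>u\<close> and \<open>v\<close>, which happens only at \<open>1\<close>.
\<close>

lemma weighted_am_gm_equality:
  fixes u v :: real
  assumes "0 < l" "0 \<le> u" "0 \<le> v" and sum: "u + real l * v \<le> real l + 1" and prod: "u * v ^ l = 1"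
  shows "u = 1" "v = 1"
proof -
  have "u \<noteq> 0" "v \<noteq> 0"
    using prod \<open>0 < l\<close> by (auto simp: power_0_left)
  then have pos: "0 < u" "0 < v"
    using assms by auto
  have "ln u + real l * ln v = ln (u * v ^ l)"
    using pos by (simp add: ln_mult ln_realpow)
  then have "ln u + real l * ln v = 0"
    by (simp add: prod)
  moreover have le: "ln u \<le> u - 1" "real l * ln v \<le> real l * (v - 1)"
    using pos ln_le_minus_one by (auto intro: mult_left_mono)
  ultimately have "ln u = u - 1" "real l * ln v = real l * (v - 1)"
    using sum by (auto simp: algebra_simps)
  then show "u = 1" "v = 1"
    using pos ln_eq_minus_one \<open>0 < l\<close> by auto
qed

text \<open>
  The four points \<open>\<plusminus>e_plus l M\<close> and \<open>\<plusminus>e_minus l M\<close>, described by equations in which their signs do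
  not occur.
\<close>

definition extremal :: "nat \<Rightarrow> real \<Rightarrow> real^3 \<Rightarrow> bool" where
  "extremal l M q \<longleftrightarrow> (q$1)\<^sup>2 = M\<^sup>2 \<and> (q$2)\<^sup>2 = real l * M\<^sup>2 \<and> q$3 = 0"

lemma power_power2_commute: "(a ^ n)\<^sup>2 = (a\<^sup>2) ^ n" for a :: real
  by (simp add: mult.commute flip: power_mult)

lemma monomial_integral_square: "(monomial_integral l q)\<^sup>2 = (q$1)\<^sup>2 * ((q$2)\<^sup>2) ^ l"
  by (simp only: monomial_integral_def power_mult_distrib power_power2_commute)

text \<open>
  On the sphere, \<open>D\<^sup>2 = x\<^sup>2 (y\<^sup>2)\<^sup>l\<close> is a power of a weighted geometric mean of \<open>x\<^sup>2\<close> and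
  \<open>y\<^sup>2\<close>, and its maximum is attained only at the extremal points.  Since \<open>C\<close> and \<open>D\<close> are first
  integrals, this is what makes a function of the two detect the equilibria.
\<close>

lemma extremal_iff_integrals:
  assumes "0 < l" "M \<noteq> 0"
  shows "extremal l M q \<longleftrightarrow> casimir q = (real l + 1) * M\<^sup>2 / 2 \<and>
    (monomial_integral l q)\<^sup>2 = M\<^sup>2 * (real l * M\<^sup>2) ^ l"
proof
  assume "extremal l M q"
  then show "casimir q = (real l + 1) * M\<^sup>2 / 2 \<and>
    (monomial_integral l q)\<^sup>2 = M\<^sup>2 * (real l * M\<^sup>2) ^ l"
    by (simp add: extremal_def casimir_def monomial_integral_square algebra_simps)
next
  assume *: "casimir q = (real l + 1) * M\<^sup>2 / 2 \<and>
    (monomial_integral l q)\<^sup>2 = M\<^sup>2 * (real l * M\<^sup>2) ^ l"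
  have M: "0 < M\<^sup>2" "0 < real l * M\<^sup>2"
    using assms by auto
  \<comment> \<open>Rescaled so that the extremal points become \<open>u = v = 1\<close>.\<close>
  define u v where "u = (q$1)\<^sup>2 / M\<^sup>2" and "v = (q$2)\<^sup>2 / (real l * M\<^sup>2)"
  have uv: "(q$1)\<^sup>2 = M\<^sup>2 * u" "(q$2)\<^sup>2 = real l * M\<^sup>2 * v"
    using assms by (simp_all add: u_def v_def)
  have sphere: "M\<^sup>2 * u + real l * M\<^sup>2 * v + (q$3)\<^sup>2 = (real l + 1) * M\<^sup>2"
    using * unfolding casimir_def uv by simp
  then have "M\<^sup>2 * (u + real l * v) \<le> M\<^sup>2 * (real l + 1)"
    by (simp add: algebra_simps) (smt (verit) zero_le_power2)
  then have sum: "u + real l * v \<le> real l + 1"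
    using M by (simp only: mult_le_cancel_left_pos)
  have "(monomial_integral l q)\<^sup>2 = (q$1)\<^sup>2 * ((q$2)\<^sup>2) ^ l"
    by (rule monomial_integral_square)
  also have "\<dots> = M\<^sup>2 * (real l * M\<^sup>2) ^ l * (u * v ^ l)"
    unfolding uv by (simp add: power_mult_distrib mult_ac)
  finally have prod: "u * v ^ l = 1"
    using * M \<open>0 < l\<close> by simp
  have "u = 1" "v = 1"
    using weighted_am_gm_equality[OF \<open>0 < l\<close> _ _ sum prod] M by (auto simp: u_def v_def)
  then show "extremal l M q"
    using sphere unfolding extremal_def uv by (simp add: algebra_simps)
qed

text \<open>
  Two different extremal points differ by a sign in a coordinate whose absolute value is at least
  \<open>\<bar>M\<bar>\<close>, so that their distance is at least \<open>2 \<bar>M\<bar>\<close>.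
\<close>

lemma extremal_isolated:
  assumes "0 < l" "M \<noteq> 0" and e: "extremal l M e" and q: "extremal l M q" and "q \<in> cball e \<bar>M\<bar>"
  shows "q = e"
proof -
  have close: "\<bar>q$i - e$i\<bar> \<le> \<bar>M\<bar>" for i
    using \<open>q \<in> cball e \<bar>M\<bar>\<close> component_le_norm_cart[of "q - e" i] by (simp add: dist_norm norm_minus_commute)
  have eq: "a = b" if "a\<^sup>2 = b\<^sup>2" "M\<^sup>2 \<le> b\<^sup>2" "\<bar>a - b\<bar> \<le> \<bar>M\<bar>" for a b :: real
  proof (rule ccontr)
    assume "a \<noteq> b"
    then have "a = - b" using that(1) by (auto simp: power2_eq_iff)
    moreover have "\<bar>M\<bar> \<le> \<bar>b\<bar>" using that(2) by (simp add: abs_le_square_iff)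
    ultimately show False using that(3) \<open>M \<noteq> 0\<close> by simp
  qed
  have "M\<^sup>2 \<le> real l * M\<^sup>2"
    using \<open>0 < l\<close> by (simp add: mult_le_cancel_right1)
  then have "q$1 = e$1" "q$2 = e$2"
    using e q by (auto simp: extremal_def intro: eq[OF _ _ close])
  moreover have "q$3 = e$3"
    using e q by (simp add: extremal_def)
  ultimately show ?thesis
    by (simp add: vec_eq_iff forall_3)
qed

lemma extremal_equilibrium:
  assumes "extremal l M e" "monomial_integral l e = - offset \<sigma> l M"
  shows "equilibrium (perturbed \<sigma> l \<epsilon> M) e"
  using assms unfolding equilibrium_def vec_eq_iff forall_3 perturbed_components
  by (simp add: extremal_def)

section \<open>Stability and attraction\<close>

text \<open>
  The first summand controls perturbations across the spheres, which makes the function useful for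
  stability in the whole space; it is constant along trajectories.
\<close>

definition lyapunov :: "real \<Rightarrow> nat \<Rightarrow> real \<Rightarrow> real^3 \<Rightarrow> real" where
  "lyapunov \<sigma> l M q = (casimir q - (real l + 1) * M\<^sup>2 / 2)\<^sup>2 + (monomial_integral l q + offset \<sigma> l M)\<^sup>2"

lemma lyapunov_derivative:
  assumes "0 < l" and "forward_trajectory (perturbed \<sigma> l \<epsilon> M) p \<gamma>" "0 \<le> t"
  shows "((\<lambda>t. lyapunov \<sigma> l M (\<gamma> t)) has_real_derivative
    - (2 * \<epsilon> * (monomial_integral l (\<gamma> t) + offset \<sigma> l M)\<^sup>2 * gram_det l (\<gamma> t))) (at t within {0..})"
proof -
  note d = forward_trajectory_has_vector_derivative[OF assms(2,3)]
  have square: "((\<lambda>t. (h t - k)\<^sup>2) has_real_derivative 2 * (h t - k) * h') (at t within {0..})"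
    if "(h has_real_derivative h') (at t within {0..})" for h :: "real \<Rightarrow> real" and h' k
    using that by (auto intro!: derivative_eq_intros)
  show ?thesis
    unfolding lyapunov_def
    using DERIV_add[OF square[OF casimir_derivative[OF d], of "(real l + 1) * M\<^sup>2 / 2"]
        square[OF monomial_integral_derivative[OF \<open>0 < l\<close> d], of "- offset \<sigma> l M"]]
    by (auto elim!: DERIV_cong simp: power2_eq_square)
qed

lemma gram_det_nonneg: "0 \<le> gram_det l q"
  by (simp add: gram_det_def)

lemma continuous_on_integrals [continuous_intros]:
  "continuous_on X casimir" "continuous_on X (monomial_integral l)" "continuous_on X (gram_det l)"
  unfolding casimir_def[abs_def] monomial_integral_def[abs_def] gram_det_def[abs_def]
  by (intro continuous_intros; simp)+

lemma offset_square: "\<bar>\<sigma>\<bar> = 1 \<Longrightarrow> (offset \<sigma> l M)\<^sup>2 = M\<^sup>2 * (real l * M\<^sup>2) ^ l"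
proof -
  assume "\<bar>\<sigma>\<bar> = 1"
  then have "\<sigma>\<^sup>2 = 1" by (metis power2_abs one_power2)
  then have "(offset \<sigma> l M)\<^sup>2 = (\<bar>M\<bar>\<^sup>2) ^ (l + 1) * ((sqrt (real l))\<^sup>2) ^ l"
    by (simp only: offset_def power_mult_distrib power_power2_commute mult_1)
  then show ?thesis by (simp add: power_mult_distrib)
qed

lemma extremal_lyapunov_stable:
  assumes "0 < l" "M \<noteq> 0" "0 \<le> \<epsilon>" "\<bar>\<sigma>\<bar> = 1"
    and e: "extremal l M e" "monomial_integral l e = - offset \<sigma> l M"
  shows "lyapunov_stable_on (perturbed \<sigma> l \<epsilon> M) UNIV e"
proof (rule lyapunov_function_imp_stable[where F = "lyapunov \<sigma> l M" and r = "\<bar>M\<bar>"])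
  show "lyapunov \<sigma> l M e = 0"
    using e extremal_iff_integrals[OF assms(1,2)] by (simp add: lyapunov_def)
  show "continuous_on UNIV (lyapunov \<sigma> l M)"
    unfolding lyapunov_def[abs_def] by (intro continuous_intros)
  fix q assume q: "q \<in> cball e \<bar>M\<bar>" "q \<noteq> e"
  then have "\<not> extremal l M q"
    using extremal_isolated[OF assms(1,2) e(1)] by blast
  then have "casimir q \<noteq> (real l + 1) * M\<^sup>2 / 2 \<or> monomial_integral l q \<noteq> - offset \<sigma> l M"
    using extremal_iff_integrals[OF assms(1,2)] offset_square[OF \<open>\<bar>\<sigma>\<bar> = 1\<close>] by auto
  then show "0 < lyapunov \<sigma> l M q"
    unfolding lyapunov_def by (auto simp: sum_power2_gt_zero_iff)
next
  fix p \<gamma> and t :: real assume \<gamma>: "forward_trajectory (perturbed \<sigma> l \<epsilon> M) p \<gamma>" and t: "0 \<le> t"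
  have "lyapunov \<sigma> l M (\<gamma> t) \<le> lyapunov \<sigma> l M (\<gamma> 0)"
    using lyapunov_derivative[OF \<open>0 < l\<close> \<gamma>] _ t
    by (rule nonincreasing_of_nonpos_derivative) (use \<open>0 \<le> \<epsilon>\<close> gram_det_nonneg in auto)
  then show "lyapunov \<sigma> l M (\<gamma> t) \<le> lyapunov \<sigma> l M p"
    using \<gamma> by (simp add: forward_trajectory_def)
qed (use perturbed_forward_trajectory_exists \<open>M \<noteq> 0\<close> in auto)

text \<open>
  On the sphere, \<open>D + k\<close> vanishes only at extremal points and so does the Gram determinant away from
  the plane \<open>y = 0\<close>.  The ball of radius \<open>\<bar>M\<bar>\<close> around \<open>e\<close> contains no other extremal point and
  does not meet that plane, because \<open>\<bar>y\<bar> = sqrt l * \<bar>M\<bar> > \<bar>M\<bar>\<close> at \<open>e\<close>; this is where \<open>l > 1\<close>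
  enters.
\<close>

lemma extremal_attracting:
  assumes "1 < l" "M \<noteq> 0" "0 < \<epsilon>" "\<bar>\<sigma>\<bar> = 1"
    and e: "extremal l M e" "monomial_integral l e = - offset \<sigma> l M"
  shows "locally_attracting_on (perturbed \<sigma> l \<epsilon> M) (casimir -` {(real l + 1) * M\<^sup>2 / 2}) e"
proof (rule strict_lyapunov_function_imp_attracting)
  have "0 < l" using \<open>1 < l\<close> by simp
  show "lyapunov_stable_on (perturbed \<sigma> l \<epsilon> M) (casimir -` {(real l + 1) * M\<^sup>2 / 2}) e"
    using \<open>0 < \<epsilon>\<close>
    by (intro lyapunov_stable_on_subset[OF extremal_lyapunov_stable[OF \<open>0 < l\<close> \<open>M \<noteq> 0\<close> _ \<open>\<bar>\<sigma>\<bar> = 1\<close> e]]) auto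
  show "closed (casimir -` {(real l + 1) * M\<^sup>2 / 2})"
    by (intro closed_vimage) (auto intro: continuous_intros)
  show "((\<lambda>t. lyapunov \<sigma> l M (\<gamma> t)) has_real_derivative
      - (2 * \<epsilon> * (monomial_integral l (\<gamma> t) + offset \<sigma> l M)\<^sup>2 * gram_det l (\<gamma> t))) (at t within {0..})"
    if "forward_trajectory (perturbed \<sigma> l \<epsilon> M) p \<gamma>" "0 \<le> t" for p \<gamma> t
    using lyapunov_derivative[OF \<open>0 < l\<close> that] .
  show "continuous_on UNIV (\<lambda>q. 2 * \<epsilon> * (monomial_integral l q + offset \<sigma> l M)\<^sup>2 * gram_det l q)"
    by (intro continuous_intros)
  fix q assume S: "q \<in> casimir -` {(real l + 1) * M\<^sup>2 / 2}" and q: "q \<in> cball e \<bar>M\<bar>" "q \<noteq> e"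
  have "\<not> extremal l M q"
    using q extremal_isolated[OF \<open>0 < l\<close> \<open>M \<noteq> 0\<close> e(1)] by blast
  then have "monomial_integral l q \<noteq> - offset \<sigma> l M"
    using extremal_iff_integrals[OF \<open>0 < l\<close> \<open>M \<noteq> 0\<close>] offset_square[OF \<open>\<bar>\<sigma>\<bar> = 1\<close>] S by auto
  moreover have "0 < gram_det l q"
  proof -
    have "q$2 \<noteq> 0"
    proof
      assume "q$2 = 0"
      then have "\<bar>e$2\<bar> \<le> \<bar>M\<bar>"
        using q component_le_norm_cart[of "e - q" 2] by (simp add: dist_norm)
      then have "real l * M\<^sup>2 \<le> M\<^sup>2"
        using e(1) by (simp add: extremal_def abs_le_square_iff)
      then show False
        using \<open>1 < l\<close> \<open>M \<noteq> 0\<close> by (simp add: mult_le_cancel_right2)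
    qed
    have "gram_det l q \<noteq> 0"
    proof
      assume "gram_det l q = 0"
      then have "(real l * (q$1)\<^sup>2 - (q$2)\<^sup>2)\<^sup>2 + (q$3)\<^sup>2 * ((q$2)\<^sup>2 + (real l)\<^sup>2 * (q$1)\<^sup>2) = 0"
        using \<open>q$2 \<noteq> 0\<close> by (simp add: gram_det_def)
      then have "real l * (q$1)\<^sup>2 = (q$2)\<^sup>2" "q$3 = 0"
        using \<open>q$2 \<noteq> 0\<close> by (auto simp: add_nonneg_eq_0_iff)
      moreover from this S have "(real l + 1) * (q$1)\<^sup>2 = (real l + 1) * M\<^sup>2"
        by (simp add: casimir_def algebra_simps)
      then have "(q$1)\<^sup>2 = M\<^sup>2"
        by simp
      ultimately show False
        using \<open>\<not> extremal l M q\<close> by (simp add: extremal_def)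
    qed
    then show ?thesis
      using gram_det_nonneg[of l q] by simp
  qed
  moreover have "0 < (monomial_integral l q + offset \<sigma> l M)\<^sup>2"
    if "monomial_integral l q \<noteq> - offset \<sigma> l M"
    using that by (metis eq_neg_iff_add_eq_0 zero_less_power2)
  ultimately show "0 < 2 * \<epsilon> * (monomial_integral l q + offset \<sigma> l M)\<^sup>2 * gram_det l q"
    using \<open>0 < \<epsilon>\<close> by simp
qed (use invariant_casimir_level \<open>M \<noteq> 0\<close> in \<open>auto simp: lyapunov_def\<close>)

lemma extremal_asymptotically_stabilized:
  assumes "1 < l" "M \<noteq> 0" "0 < \<epsilon>" "\<bar>\<sigma>\<bar> = 1"
    and e: "extremal l M e" "monomial_integral l e = - offset \<sigma> l M"
  shows "asymptotically_stabilizes_along (casimir -` {(real l + 1) * M\<^sup>2 / 2})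
    (rattleback l) (perturbed \<sigma> l \<epsilon> M) e"
proof -
  have "0 < l" "0 \<le> \<epsilon>" using assms by auto
  then show ?thesis
    unfolding asymptotically_stabilizes_along_def asymptotically_stable_on_def rattleback_eq_perturbed[of l \<sigma> M]
    using extremal_attracting[OF assms] extremal_equilibrium[OF e] invariant_casimir_level
      extremal_iff_integrals[OF \<open>0 < l\<close> \<open>M \<noteq> 0\<close>, of e]
      lyapunov_stable_on_subset[OF extremal_lyapunov_stable[OF \<open>0 < l\<close> \<open>M \<noteq> 0\<close> \<open>0 \<le> \<epsilon>\<close> \<open>\<bar>\<sigma>\<bar> = 1\<close> e]] e
    by auto
qed

lemma extremal_equilibria:
  "extremal l M (e_plus l M)" "extremal l M (- e_plus l M)"
  "extremal l M (e_minus l M)" "extremal l M (- e_minus l M)"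
  by (simp_all add: extremal_def e_plus_def e_minus_def power_mult_distrib)

text \<open>
  The value of \<open>D\<close> at each equilibrium is \<open>\<plusminus>\<bar>k\<bar>\<close>; its sign decides which of the two perturbations
  stabilizes it.
\<close>

lemma monomial_integral_equilibria:
  "monomial_integral l (e_plus l M) = offset 1 l M"
  "monomial_integral l (- e_plus l M) = offset ((-1) ^ (l + 1)) l M"
  "monomial_integral l (e_minus l M) = offset ((-1) ^ l) l M"
  "monomial_integral l (- e_minus l M) = offset (-1) l M"
  by (simp_all add: monomial_integral_def offset_def e_plus_def e_minus_def power_mult_distrib
      power_minus[of "_ * _"] power_minus[of "\<bar>M\<bar>"] mult_ac)

lemma offset_minus: "offset (- \<sigma>) l M = - offset \<sigma> l M"
  by (simp add: offset_def)

text \<open>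
  Here the sign of the vanishing perturbation is free and is chosen to fit the value of \<open>D\<close> at \<open>e\<close>.
\<close>

lemma rattleback_extremal_stable:
  assumes "0 < l" "M \<noteq> 0" "\<bar>\<sigma>\<bar> = 1" and e: "extremal l M e" "monomial_integral l e = offset \<sigma> l M"
  shows "equilibrium (rattleback l) e" "lyapunov_stable_on (rattleback l) UNIV e"
proof -
  have "monomial_integral l e = - offset (- \<sigma>) l M" "\<bar>- \<sigma>\<bar> = 1"
    using e(2) \<open>\<bar>\<sigma>\<bar> = 1\<close> by (simp_all add: offset_minus)
  then show "equilibrium (rattleback l) e" "lyapunov_stable_on (rattleback l) UNIV e"
    unfolding rattleback_eq_perturbed[of l "- \<sigma>" M]
    using extremal_equilibrium extremal_lyapunov_stable[OF \<open>0 < l\<close> \<open>M \<noteq> 0\<close> order_refl] e(1) by auto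
qed
theorem theorem9p1:
  fixes l :: nat and \<epsilon> M :: real
  assumes "l > 1" and "\<epsilon> > 0" and "M \<noteq> 0"
  defines "S \<equiv> casimir -` {(real l + 1) * M^2 / 2}"
  shows "(\<forall>e \<in> {e_minus l M, - e_minus l M, e_plus l M, - e_plus l M}.
            equilibrium (rattleback l) e \<and> lyapunov_stable_on (rattleback l) UNIV e)
    \<and> (even l \<longrightarrow>
         (\<forall>e \<in> {e_minus l M, e_plus l M}.
            asymptotically_stabilizes_along S (rattleback l) (p_minus l \<epsilon> M) e) \<and>
         (\<forall>e \<in> {- e_minus l M, - e_plus l M}.
            asymptotically_stabilizes_along S (rattleback l) (p_plus l \<epsilon> M) e))
    \<and> (odd l \<longrightarrow>
         (\<forall>e \<in> {- e_plus l M, e_plus l M}.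
            asymptotically_stabilizes_along S (rattleback l) (p_minus l \<epsilon> M) e) \<and>
         (\<forall>e \<in> {- e_minus l M, e_minus l M}.
            asymptotically_stabilizes_along S (rattleback l) (p_plus l \<epsilon> M) e))"

proof -
  have l: "0 < l" using \<open>l > 1\<close> by simp
  have sign: "\<bar>(-1) ^ l\<bar> = (1::real)" "\<bar>(-1) ^ (l + 1)\<bar> = (1::real)"
    by (simp_all add: power_abs)
  note stable = rattleback_extremal_stable[OF l \<open>M \<noteq> 0\<close>]
  note stabilized = extremal_asymptotically_stabilized[OF \<open>l > 1\<close> \<open>M \<noteq> 0\<close> \<open>\<epsilon> > 0\<close>, folded S_def]
  note eqs = monomial_integral_equilibria offset_minus
  have "\<forall>e \<in> {e_minus l M, - e_minus l M, e_plus l M, - e_plus l M}.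
      equilibrium (rattleback l) e \<and> lyapunov_stable_on (rattleback l) UNIV e"
    using stable[OF _ extremal_equilibria(1) eqs(1)] stable[OF sign(2) extremal_equilibria(2) eqs(2)]
      stable[OF sign(1) extremal_equilibria(3) eqs(3)] stable[OF _ extremal_equilibria(4) eqs(4)]
    by simp
  moreover have "asymptotically_stabilizes_along S (rattleback l) (p_minus l \<epsilon> M) e"
    if "even l \<and> e \<in> {e_minus l M, e_plus l M} \<or> odd l \<and> e \<in> {- e_plus l M, e_plus l M}" for e
    unfolding p_minus_def using that by (intro stabilized) (auto simp: extremal_equilibria eqs)
  moreover have "asymptotically_stabilizes_along S (rattleback l) (p_plus l \<epsilon> M) e"
    if "even l \<and> e \<in> {- e_minus l M, - e_plus l M} \<or> odd l \<and> e \<in> {- e_minus l M, e_minus l M}" for e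
    unfolding p_plus_def using that by (intro stabilized) (auto simp: extremal_equilibria eqs)
  ultimately show ?thesis
    by blast
qed

end
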